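(* Let $n\ge 2$ be an integer. For all $m\ge n-1$ and all $k\ge 0$, $$D^{\mathrm{VR}}_{n,k}(\mathbb S^m_E)=D^{\mathrm{VR}}_{n,k}(\mathbb S^{n-1}_E)=\bigcup_{\lambda\in[0,1]}\lambda\cdot D^{\mathrm{VR}}_{n,k}(\mathbb S^{n-2}_E).$$
   Context: $\mathbb S^m_E$ is the unit sphere in $\mathbb R^{m+1}$ with the (restricted) Euclidean metric. For a finite metric space $Y$ and $r\ge 0$, $\mathrm{VR}_r(Y)$ is the simplicial complex of nonempty subsets $\sigma\subset Y$ with $\mathrm{diam}(\sigma)\le r$. With a fixed coefficient field $\mathbb F$, the persistence module $r\mapsto\widetilde H_k(\mathrm{VR}_r(Y);\mathbb F)$ (reduced homology) decomposes into finitely many interval modules on intervals $[b_\alpha,d_\alpha)$, and $\mathrm{dgm}_k^{\mathrm{VR}}(Y)$ is the multiset of points $(b_\alpha,d_\alpha)$. For a metric space $X$, $D^{\mathrm{VR}}_{n,k}(X):=\{\mathrm{dgm}_k^{\mathrm{VR}}(X'):X'\subset X,\ |X'|\le n\}$; it always contains the empty diagram. For $\lambda>0$ and a diagram $D$, $\lambda\cdot D$ is obtained by multiplying every point of $D$ by $\lambda$; $0\cdot D$ is the empty diagram (points on the diagonal are discarded). For a set $S$ of diagrams, $\lambda\cdot S=\{\lambda\cdot D:D\in S\}$. *)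

theory Defs
  imports "HOL-Analysis.Analysis" "HOL-Combinatorics.Permutations" "HOL-Library.Multiset"
begin

section \<open>Euclidean spheres as metric spaces\<close>

definition Euclidean_dist :: "nat \<Rightarrow> (nat \<Rightarrow> real) \<Rightarrow> (nat \<Rightarrow> real) \<Rightarrow> real" where
  "Euclidean_dist N x y = L2_set (\<lambda>i. x i - y i) {..<N}"

definition Euclidean_metric :: "nat \<Rightarrow> (nat \<Rightarrow> real) metric" where
  "Euclidean_metric N = metric (topspace (Euclidean_space N), Euclidean_dist N)"

lemma Metric_space_Euclidean_dist:
  "Metric_space (topspace (Euclidean_space N)) (Euclidean_dist N)"
proof
  fix x y z :: "nat \<Rightarrow> real"
  show "0 \<le> Euclidean_dist N x y"
    by (simp add: Euclidean_dist_def L2_set_nonneg)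
  show "Euclidean_dist N x y = Euclidean_dist N y x"
    by (simp add: Euclidean_dist_def L2_set_def power2_commute)
  assume xy: "x \<in> topspace (Euclidean_space N)" "y \<in> topspace (Euclidean_space N)"
  then have "(\<forall>i<N. x i = y i) \<longleftrightarrow> x = y"
    by (auto simp: topspace_Euclidean_space fun_eq_iff) (metis not_less)
  then show "Euclidean_dist N x y = 0 \<longleftrightarrow> x = y"
    by (simp add: Euclidean_dist_def L2_set_eq_0_iff lessThan_def)
  show "Euclidean_dist N x z \<le> Euclidean_dist N x y + Euclidean_dist N y z"
    using L2_set_triangle_ineq[of "\<lambda>i. x i - y i" "\<lambda>i. y i - z i" "{..<N}"]
    by (simp add: Euclidean_dist_def)
qed

lemma mspace_Euclidean_metric [simp]:
  "mspace (Euclidean_metric N) = topspace (Euclidean_space N)"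
  and mdist_Euclidean_metric [simp]: "mdist (Euclidean_metric N) = Euclidean_dist N"
  using Metric_space.mspace_metric[OF Metric_space_Euclidean_dist]
    Metric_space.mdist_metric[OF Metric_space_Euclidean_dist]
  by (simp_all add: Euclidean_metric_def)

definition Euclidean_sphere :: "nat \<Rightarrow> (nat \<Rightarrow> real) metric" where
  "Euclidean_sphere m = submetric (Euclidean_metric (Suc m)) (topspace (nsphere m))"

lemma mspace_Euclidean_sphere:
  "mspace (Euclidean_sphere m) = {x. (\<forall>i\<ge>Suc m. x i = 0) \<and> (\<Sum>i\<le>m. (x i)\<^sup>2) = 1}"
  by (auto simp: Euclidean_sphere_def nsphere_def topspace_Euclidean_space)

lemma mdist_Euclidean_sphere:
  "mdist (Euclidean_sphere m) x y = sqrt (\<Sum>i\<le>m. (x i - y i)\<^sup>2)"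
  by (simp add: Euclidean_sphere_def Euclidean_dist_def L2_set_def lessThan_Suc_atMost)


section \<open>Reduced simplicial homology over a field\<close>

text \<open>
  An abstract simplicial complex is given by its set \<open>K\<close> of (nonempty, finite) simplices. We use
  oriented chains in Munkres' sense: a chain is a finitely supported function on ordered simplices
  \<open>[v\<^sub>0, \<dots>, v\<^sub>q]\<close> that changes sign under odd reorderings of the vertices. The argument \<open>p\<close> of
  \<open>chains K p\<close> counts vertices, so the chains have dimension \<open>p - 1\<close>; \<open>p = 0\<close> is the augmentation
  term, spanned by the empty simplex, which makes the homology reduced.
\<close>

definition chains :: "'a set set \<Rightarrow> nat \<Rightarrow> ('a list \<Rightarrow> 'f::field) set" where
  "chains K p =
     {c. finite {s. c s \<noteq> 0} \<and>
         (\<forall>s. c s \<noteq> 0 \<longrightarrow> distinct s \<and> length s = p \<and> set s \<in> insert {} K) \<and>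
         (\<forall>s \<pi>. \<pi> permutes {..<length s} \<longrightarrow> c (permute_list \<pi> s) = of_int (sign \<pi>) * c s)}"

text \<open>
  This is \<open>\<partial>[v\<^sub>0, \<dots>, v\<^sub>q] = (\<Sum>i\<le>q. (-1)\<^sup>i [v\<^sub>0, \<dots>, v\<^sub>i\<^sub>-\<^sub>1, v\<^sub>i\<^sub>+\<^sub>1, \<dots>, v\<^sub>q])\<close>, written on coefficients: moving \<open>v\<^sub>i\<close>
  to the front of \<open>[v\<^sub>0, \<dots>, v\<^sub>q]\<close> is a permutation of sign \<open>(-1)\<^sup>i\<close>, so the coefficient of \<open>\<partial>c\<close> at \<open>s\<close>
  is the sum of the coefficients of \<open>c\<close> at all \<open>v # s\<close>. For \<open>q = 0\<close> it is the augmentation.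
\<close>

definition boundary :: "('a list \<Rightarrow> 'f::field) \<Rightarrow> 'a list \<Rightarrow> 'f" where
  "boundary c s = (\<Sum>v | c (v # s) \<noteq> 0. c (v # s))"

definition cycles :: "'a set set \<Rightarrow> nat \<Rightarrow> ('a list \<Rightarrow> 'f::field) set" where
  "cycles K k = {c \<in> chains K (Suc k). boundary c = (\<lambda>_. 0)}"

definition boundaries :: "'a set set \<Rightarrow> nat \<Rightarrow> ('a list \<Rightarrow> 'f::field) set" where
  "boundaries K k = boundary ` chains K (Suc (Suc k))"

definition homologous ::
    "'a set set \<Rightarrow> nat \<Rightarrow> (('a list \<Rightarrow> 'f::field) \<times> ('a list \<Rightarrow> 'f)) set" where
  "homologous K k =
     {(z, w). z \<in> cycles K k \<and> w \<in> cycles K k \<and> (\<lambda>s. z s - w s) \<in> boundaries K k}"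

definition homology :: "'a set set \<Rightarrow> nat \<Rightarrow> ('a list \<Rightarrow> 'f::field) set set" where
  "homology K k = cycles K k // homologous K k"

definition homology_add :: "'a set set \<Rightarrow> nat \<Rightarrow>
    ('a list \<Rightarrow> 'f::field) set \<Rightarrow> ('a list \<Rightarrow> 'f) set \<Rightarrow> ('a list \<Rightarrow> 'f) set" where
  "homology_add K k X Y = (\<Union>z\<in>X. \<Union>w\<in>Y. homologous K k `` {\<lambda>s. z s + w s})"

definition homology_scale :: "'a set set \<Rightarrow> nat \<Rightarrow>
    'f::field \<Rightarrow> ('a list \<Rightarrow> 'f) set \<Rightarrow> ('a list \<Rightarrow> 'f) set" where
  "homology_scale K k a X = (\<Union>z\<in>X. homologous K k `` {\<lambda>s. a * z s})"

text \<open>The map into the homology of \<open>L\<close> induced by an inclusion \<open>K \<subseteq> L\<close> of complexes.\<close>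

definition homology_incl ::
    "'a set set \<Rightarrow> nat \<Rightarrow> ('a list \<Rightarrow> 'f::field) set \<Rightarrow> ('a list \<Rightarrow> 'f) set" where
  "homology_incl L k X = (\<Union>z\<in>X. homologous L k `` {z})"


section \<open>Persistence modules\<close>

text \<open>
  Persistence modules indexed by the reals \<open>t \<ge> 0\<close>: vector spaces \<open>pspace P t\<close> with their operations,
  and structure maps \<open>pmap P s t\<close> for \<open>0 \<le> s \<le> t\<close>.
\<close>

record ('f, 'v) pmodule =
  pspace :: "real \<Rightarrow> 'v set"
  padd :: "real \<Rightarrow> 'v \<Rightarrow> 'v \<Rightarrow> 'v"
  pscale :: "real \<Rightarrow> 'f \<Rightarrow> 'v \<Rightarrow> 'v"
  pmap :: "real \<Rightarrow> real \<Rightarrow> 'v \<Rightarrow> 'v"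

definition pmodule_iso :: "('f, 'v) pmodule \<Rightarrow> ('f, 'w) pmodule \<Rightarrow> bool" where
  "pmodule_iso P Q \<longleftrightarrow>
     (\<exists>\<phi>. (\<forall>t\<ge>0. bij_betw (\<phi> t) (pspace P t) (pspace Q t) \<and>
                 (\<forall>x\<in>pspace P t. \<forall>y\<in>pspace P t. \<phi> t (padd P t x y) = padd Q t (\<phi> t x) (\<phi> t y)) \<and>
                 (\<forall>a. \<forall>x\<in>pspace P t. \<phi> t (pscale P t a x) = pscale Q t a (\<phi> t x))) \<and>
          (\<forall>s t. 0 \<le> s \<and> s \<le> t \<longrightarrow>
                 (\<forall>x\<in>pspace P s. \<phi> t (pmap P s t x) = pmap Q s t (\<phi> s x))))"

text \<open>
  The direct sum of the interval modules on \<open>[b\<^sub>i, d\<^sub>i)\<close>, where \<open>ps = [(b\<^sub>0, d\<^sub>0), (b\<^sub>1, d\<^sub>1), \<dots>]\<close>;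
  \<open>x i\<close> is the component of \<open>x\<close> in the \<open>i\<close>-th summand.
\<close>

definition interval_support :: "(real \<times> real) list \<Rightarrow> real \<Rightarrow> nat set" where
  "interval_support ps t = {i. i < length ps \<and> t \<in> {fst (ps ! i)..<snd (ps ! i)}}"

definition interval_sum :: "(real \<times> real) list \<Rightarrow> ('f::field, nat \<Rightarrow> 'f) pmodule" where
  "interval_sum ps =
     \<lparr>pspace = (\<lambda>t. {x. \<forall>i. i \<notin> interval_support ps t \<longrightarrow> x i = 0}),
      padd = (\<lambda>t x y i. x i + y i),
      pscale = (\<lambda>t a x i. a * x i),
      pmap = (\<lambda>s t x i. if i \<in> interval_support ps t then x i else 0)\<rparr>"


section \<open>Vietoris-Rips persistence diagrams\<close>

definition diam :: "'a metric \<Rightarrow> 'a set \<Rightarrow> real" where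
  "diam X S = (if S = {} then 0 else SUP (x, y)\<in>S \<times> S. mdist X x y)"

definition VR :: "'a metric \<Rightarrow> real \<Rightarrow> 'a set set" where
  "VR X r = {\<sigma>. \<sigma> \<noteq> {} \<and> finite \<sigma> \<and> \<sigma> \<subseteq> mspace X \<and> diam X \<sigma> \<le> r}"

definition VR_module ::
    "'f::field itself \<Rightarrow> nat \<Rightarrow> 'a metric \<Rightarrow> ('f, ('a list \<Rightarrow> 'f) set) pmodule" where
  "VR_module F k X =
     \<lparr>pspace = (\<lambda>r. homology (VR X r) k),
      padd = (\<lambda>r. homology_add (VR X r) k),
      pscale = (\<lambda>r. homology_scale (VR X r) k),
      pmap = (\<lambda>r s. homology_incl (VR X s) k)\<rparr>"

text \<open>
  \<open>is_dgm F k X D\<close>: the multiset \<open>D\<close> is the degree \<open>k\<close> Vietoris-Rips persistence diagram of \<open>X\<close>. For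
  finite \<open>X\<close> exactly one such \<open>D\<close> exists. Real endpoints suffice: \<open>VR X r\<close> is a full simplex (or empty)
  for large \<open>r\<close>, so every interval in reduced homology of degree \<open>k \<ge> 0\<close> is bounded.
\<close>

definition is_dgm ::
    "'f::field itself \<Rightarrow> nat \<Rightarrow> 'a metric \<Rightarrow> (real \<times> real) multiset \<Rightarrow> bool" where
  "is_dgm F k X D \<longleftrightarrow>
     (\<exists>ps. mset ps = D \<and> (\<forall>(b, d)\<in>set ps. 0 \<le> b \<and> b < d) \<and>
           pmodule_iso (VR_module F k X) (interval_sum ps))"

definition dgm_set ::
    "'f::field itself \<Rightarrow> nat \<Rightarrow> nat \<Rightarrow> 'a metric \<Rightarrow> (real \<times> real) multiset set" where
  "dgm_set F n k X =
     {D. \<exists>X'\<subseteq>mspace X. finite X' \<and> card X' \<le> n \<and> is_dgm F k (submetric X X') D}"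

definition scale_dgm :: "real \<Rightarrow> (real \<times> real) multiset \<Rightarrow> (real \<times> real) multiset" where
  "scale_dgm l D = (if l = 0 then {#} else image_mset (\<lambda>(b, d). (l * b, l * d)) D)"

end

theory Submission
  imports Defs
begin

text \<open>
  At most \<open>n\<close> points of \<open>\<real>\<^sup>N\<close> lie in a linear subspace of dimension \<open>n\<close> and in an affine subspace of
  dimension \<open>n - 1\<close>. Rotating the linear span into a coordinate subspace brings \<open>n\<close> points of a sphere
  of dimension \<open>m \<ge> n\<close> into the equatorial sphere of dimension \<open>m - 1\<close>. Rotating the affine hull
  of \<open>n\<close> points of \<open>S\<^sup>n\<^sup>-\<^sup>1\<close> into a hyperplane \<open>x\<^sub>n = c\<close> puts them on a parallel of that sphere, a copy of
  \<open>S\<^sup>n\<^sup>-\<^sup>2\<close> scaled by \<open>l = sqrt (1 - c\<^sup>2)\<close>; every \<open>l \<in> {0<..1}\<close> occurs. Persistence diagrams scale with the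
  metric.
\<close>

section \<open>Relabelling the vertices of a complex\<close>

text \<open>The pushforward of a chain along \<open>h\<close>. A chain is a function of
  coefficients, so its argument is pulled back by \<open>inv h\<close>; for this to be invertible,
  \<open>h\<close> is always a bijection between whole types.\<close>

definition relabel :: "('a \<Rightarrow> 'b) \<Rightarrow> ('a list \<Rightarrow> 'f) \<Rightarrow> 'b list \<Rightarrow> 'f" where
  "relabel h c s = c (map (inv h) s)"

lemma relabel_relabel_inv:
  assumes "bij h"
  shows "relabel (inv h) (relabel h c) = c" "relabel h (relabel (inv h) d) = d"
  using assms by (auto simp: relabel_def fun_eq_iff inv_inv_eq o_def bij_is_inj bij_is_surj surj_f_inv_f
      intro!: arg_cong[where f = c] arg_cong[where f = d] map_idI)

lemma inj_relabel: "bij h \<Longrightarrow> inj (relabel h)"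
  by (metis injI relabel_relabel_inv(1))

lemma image_relabel_eqI:
  assumes h: "bij h"
    and "\<And>c. c \<in> A \<Longrightarrow> relabel h c \<in> B"
    and "\<And>d. d \<in> B \<Longrightarrow> relabel (inv h) d \<in> A"
  shows "relabel h ` A = B"
  using assms relabel_relabel_inv(2)[OF h] by (metis image_eqI image_subsetI subsetI subset_antisym)

lemma image_image_inv:
  assumes "bij h"
  shows "(`) (inv h) ` (`) h ` K = K"
  using assms by (simp add: image_image bij_is_inj inv_f_f)

text \<open>The support moves along \<open>map h\<close>, and permuting the entries of a list
  commutes with relabelling them. Hence finiteness, the simplex condition and the sign rule all
  carry over.\<close>

lemma relabel_in_chains:
  assumes h: "bij h" and c: "c \<in> chains K p"
  shows "relabel h c \<in> chains ((`) h ` K) p"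
proof -
  have inv: "h (inv h x) = x" "inv h (h y) = y" for x y
    using h by (simp_all add: bij_is_surj surj_f_inv_f bij_is_inj)
  have "{s. relabel h c s \<noteq> 0} \<subseteq> map h ` {s. c s \<noteq> 0}"
  proof
    fix s assume "s \<in> {s. relabel h c s \<noteq> 0}"
    then have "map (inv h) s \<in> {s. c s \<noteq> 0}"
      by (simp add: relabel_def)
    moreover have "s = map h (map (inv h) s)"
      by (simp add: o_def inv)
    ultimately show "s \<in> map h ` {s. c s \<noteq> 0}"
      by (rule rev_image_eqI)
  qed
  then have 1: "finite {s. relabel h c s \<noteq> 0}"
    using c finite_subset by (auto simp: chains_def)
  have 2: "distinct s \<and> length s = p \<and> set s \<in> insert {} ((`) h ` K)" if "relabel h c s \<noteq> 0" for s
  proof -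
    have "distinct (map (inv h) s)" "length s = p" "inv h ` set s \<in> insert {} K"
      using c that unfolding chains_def relabel_def by auto
    moreover have "set s = h ` inv h ` set s"
      by (simp add: image_image inv)
    ultimately show ?thesis
      by (auto simp: distinct_map)
  qed
  have 3: "relabel h c (permute_list \<pi> s) = of_int (sign \<pi>) * relabel h c s"
    if "\<pi> permutes {..<length s}" for s \<pi>
    using c that by (simp add: chains_def relabel_def flip: permute_list_map)
  show ?thesis
    unfolding chains_def using 1 2 3 by blast
qed

lemma chains_image:
  assumes "bij h"
  shows "chains ((`) h ` K) p = relabel h ` chains K p"
  using image_relabel_eqI[OF assms] relabel_in_chains[OF assms]
    relabel_in_chains[OF bij_imp_bij_inv[OF assms], of _ "(`) h ` K"] image_image_inv[OF assms]
  by (metis (no_types, lifting))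

lemma boundary_relabel:
  assumes "bij h"
  shows "boundary (relabel h c) = relabel h (boundary c)"
proof
  fix s
  show "boundary (relabel h c) s = relabel h (boundary c) s"
    unfolding boundary_def relabel_def
    by (rule sum.reindex_bij_witness[of _ h "inv h"])
      (use assms in \<open>auto simp: bij_is_surj surj_f_inv_f bij_is_inj\<close>)
qed

lemma cycles_image:
  fixes h :: "'a \<Rightarrow> 'b"
  assumes "bij h"
  shows "(cycles ((`) h ` K) k :: ('b list \<Rightarrow> 'f::field) set) = relabel h ` cycles K k"
proof -
  \<comment> \<open>An injective map that fixes the zero chain preserves and reflects the vanishing
    of a boundary.\<close>
  have "relabel h d = (\<lambda>_. 0) \<longleftrightarrow> d = (\<lambda>_. 0)" for d :: "'a list \<Rightarrow> 'f"
    using inj_eq[OF inj_relabel[OF assms], of d "\<lambda>_. 0"] by (simp add: relabel_def[abs_def])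
  then have "relabel h c \<in> cycles ((`) h ` K) k \<longleftrightarrow> c \<in> cycles K k" for c :: "'a list \<Rightarrow> 'f"
    by (simp add: cycles_def chains_image boundary_relabel assms inj_image_mem_iff inj_relabel)
  then show ?thesis
    using image_relabel_eqI[OF assms, of "cycles K k" "cycles ((`) h ` K) k"]
      relabel_relabel_inv(2)[OF assms] by metis
qed

lemma boundaries_image:
  assumes "bij h"
  shows "boundaries ((`) h ` K) k = relabel h ` boundaries K k"
  by (simp add: boundaries_def chains_image boundary_relabel assms image_image)

lemma homologous_image_iff:
  assumes "bij h"
  shows "(relabel h z, relabel h w) \<in> homologous ((`) h ` K) k \<longleftrightarrow> (z, w) \<in> homologous K k"
proof -
  have "(\<lambda>s. relabel h z s - relabel h w s) = relabel h (\<lambda>s. z s - w s)"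
    by (simp add: relabel_def fun_eq_iff)
  then show ?thesis
    by (simp add: homologous_def cycles_image boundaries_image assms inj_image_mem_iff inj_relabel)
qed

text \<open>A homology class is a set of chains, so the map that \<open>h\<close> induces on
  homology is taking images under \<open>relabel h\<close>. The lemmas after this one show that it
  respects addition, scalars and inclusions.\<close>

lemma homology_class_image:
  assumes "bij h"
  shows "homologous ((`) h ` K) k `` {relabel h z} = relabel h ` (homologous K k `` {z})"
  using image_relabel_eqI[OF assms] homologous_image_iff[OF assms] relabel_relabel_inv(2)[OF assms]
  by (metis (no_types, lifting) Image_singleton_iff)

lemma homology_image:
  assumes "bij h"
  shows "homology ((`) h ` K) k = (`) (relabel h) ` homology K k"
  by (auto simp: homology_def quotient_def cycles_image homology_class_image assms)

lemma homology_add_image: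
  fixes X :: "('a list \<Rightarrow> 'f::field) set"
  assumes "bij h"
  shows "homology_add ((`) h ` K) k (relabel h ` X) (relabel h ` Y) = relabel h ` homology_add K k X Y"
proof -
  have "(\<lambda>s. relabel h z s + relabel h w s) = relabel h (\<lambda>s. z s + w s)"
    for z w :: "'a list \<Rightarrow> 'f"
    by (simp add: relabel_def fun_eq_iff)
  then show ?thesis
    by (simp add: homology_add_def homology_class_image assms image_UN)
qed

lemma homology_scale_image:
  assumes "bij h"
  shows "homology_scale ((`) h ` K) k a (relabel h ` X) = relabel h ` homology_scale K k a X"
proof -
  have "(\<lambda>s. a * relabel h z s) = relabel h (\<lambda>s. a * z s)" for z
    by (simp add: relabel_def fun_eq_iff)
  then show ?thesis
    by (simp add: homology_scale_def homology_class_image assms image_UN)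
qed

lemma homology_incl_image:
  assumes "bij h"
  shows "homology_incl ((`) h ` L) k (relabel h ` X) = relabel h ` homology_incl L k X"
  by (simp add: homology_incl_def homology_class_image assms image_UN)


section \<open>Diagrams under similarities\<close>

text \<open>Finiteness bounds the distances from above, which gives the supremum in
  \<open>diam\<close> its meaning.\<close>

lemma diam_le_iff:
  assumes "finite S" "S \<noteq> {}"
  shows "diam X S \<le> r \<longleftrightarrow> (\<forall>x\<in>S. \<forall>y\<in>S. mdist X x y \<le> r)"
proof -
  have "bdd_above ((\<lambda>(x, y). mdist X x y) ` (S \<times> S))"
    using assms by (intro bdd_above_finite) simp
  then show ?thesis
    using assms by (simp add: diam_def cSUP_le_iff)
qed

lemma VR_image:
  assumes "bij g" and l: "l > 0" and "g ` mspace Y = mspace X"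
    and dist: "\<And>x y. x \<in> mspace Y \<Longrightarrow> y \<in> mspace Y \<Longrightarrow> mdist Y x y = l * mdist X (g x) (g y)"
  shows "VR X (t / l) = (`) g ` VR Y t"
proof -
  have mem: "g ` S \<in> VR X (t / l) \<longleftrightarrow> S \<in> VR Y t" for S
  proof -
    have sub: "g ` S \<subseteq> mspace X \<longleftrightarrow> S \<subseteq> mspace Y"
      using assms by (metis bij_is_inj inj_image_subset_iff)
    have fin: "finite (g ` S) \<longleftrightarrow> finite S"
      using assms(1) by (meson bij_is_inj finite_image_iff inj_on_subset subset_UNIV)
    have "diam X (g ` S) \<le> t / l \<longleftrightarrow> diam Y S \<le> t"
      if S: "finite S" "S \<noteq> {}" "S \<subseteq> mspace Y"
    proof -
      have "mdist X (g x) (g y) \<le> t / l \<longleftrightarrow> mdist Y x y \<le> t" if "x \<in> S" "y \<in> S" for x y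
        using that S(3) l by (simp add: dist subset_iff field_simps)
      then show ?thesis
        using S by (simp add: diam_le_iff)
    qed
    then show ?thesis
      unfolding VR_def using sub fin by auto
  qed
  show ?thesis
  proof (intro subset_antisym subsetI)
    fix U assume "U \<in> VR X (t / l)"
    moreover have "U = g ` inv g ` U"
      using assms(1) by (simp add: image_f_inv_f bij_is_surj)
    ultimately show "U \<in> (`) g ` VR Y t"
      using mem by (metis imageI)
  qed (use mem in auto)
qed

lemma interval_support_scale:
  assumes "l > 0"
  shows "interval_support (map (\<lambda>(b, d). (l * b, l * d)) ps) t = interval_support ps (t / l)"
  using assms by (auto simp: interval_support_def case_prod_unfold field_simps)

text \<open>The complex of \<open>Y\<close> at scale \<open>t\<close> is a relabelled copy of the
  complex of \<open>X\<close> at scale \<open>t / l\<close>. Reparametrising an interval module on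
  \<open>[b, d)\<close> in this way gives the one on \<open>[l * b, l * d)\<close>.\<close>

lemma is_dgm_similarity:
  fixes F :: "'f::field itself" and X :: "'a metric"
  assumes g: "bij g" and l: "l > 0" and "g ` mspace Y = mspace X"
    and "\<And>x y. x \<in> mspace Y \<Longrightarrow> y \<in> mspace Y \<Longrightarrow> mdist Y x y = l * mdist X (g x) (g y)"
    and D: "is_dgm F k X D"
  shows "is_dgm F k Y (scale_dgm l D)"
proof -
  note VR = VR_image[OF assms(1-4)]
  obtain ps where ps: "mset ps = D" "\<And>b d. (b, d) \<in> set ps \<Longrightarrow> 0 \<le> b \<and> b < d"
    and iso: "pmodule_iso (VR_module F k X) (interval_sum ps)"
    using D unfolding is_dgm_def by auto
  define qs where "qs = map (\<lambda>(b, d). (l * b, l * d)) ps"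
  have supp: "interval_support qs t = interval_support ps (t / l)" for t
    using interval_support_scale[OF l] by (simp add: qs_def)
  obtain \<phi> :: "real \<Rightarrow> ('a list \<Rightarrow> 'f) set \<Rightarrow> nat \<Rightarrow> 'f" where \<phi>:
    "\<forall>t\<ge>0. bij_betw (\<phi> t) (homology (VR X t) k) (pspace (interval_sum ps) t) \<and>
       (\<forall>A\<in>homology (VR X t) k. \<forall>B\<in>homology (VR X t) k.
          \<phi> t (homology_add (VR X t) k A B) = padd (interval_sum ps) t (\<phi> t A) (\<phi> t B)) \<and>
       (\<forall>a. \<forall>A\<in>homology (VR X t) k.
          \<phi> t (homology_scale (VR X t) k a A) = pscale (interval_sum ps) t a (\<phi> t A))"
    and \<phi>_incl:
    "\<forall>s t. 0 \<le> s \<and> s \<le> t \<longrightarrow> (\<forall>A\<in>homology (VR X s) k.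
       \<phi> t (homology_incl (VR X t) k A) = pmap (interval_sum ps) s t (\<phi> s A))"
    using iso unfolding pmodule_iso_def VR_module_def pmodule.simps by (elim exE conjE)
  have bij: "bij_betw (\<phi> t) (homology (VR X t) k) (pspace (interval_sum ps) t)"
    and add: "\<And>A B. A \<in> homology (VR X t) k \<Longrightarrow> B \<in> homology (VR X t) k \<Longrightarrow>
      \<phi> t (homology_add (VR X t) k A B) = padd (interval_sum ps) t (\<phi> t A) (\<phi> t B)"
    and scale: "\<And>a A. A \<in> homology (VR X t) k \<Longrightarrow>
      \<phi> t (homology_scale (VR X t) k a A) = pscale (interval_sum ps) t a (\<phi> t A)"
    if "0 \<le> t" for t
    using \<phi> that by simp_all
  have incl: "\<phi> t (homology_incl (VR X t) k A) = pmap (interval_sum ps) s t (\<phi> s A)"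
    if "0 \<le> s" "s \<le> t" "A \<in> homology (VR X s) k" for s t A
    using \<phi>_incl that by simp
  \<comment> \<open>Carry a class of \<open>Y\<close> at scale \<open>t\<close> to \<open>X\<close>
    at scale \<open>t / l\<close>, then apply the given isomorphism there.\<close>
  define \<psi> where "\<psi> t A = \<phi> (t / l) (relabel g ` A)" for t A
  have hom: "homology (VR X (t / l)) k = (`) (relabel g) ` homology (VR Y t) k" for t
    by (simp add: VR homology_image g)
  have t_l: "0 \<le> t / l \<longleftrightarrow> 0 \<le> t" "s / l \<le> t / l \<longleftrightarrow> s \<le> t" for s t
    using l by (simp_all add: field_simps)
  have "pmodule_iso (VR_module F k Y) (interval_sum qs)"
    unfolding pmodule_iso_def
  proof (intro exI[of _ \<psi>] conjI allI impI ballI)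
    fix t :: real assume t: "0 \<le> t"
    then have t': "0 \<le> t / l"
      using t_l by simp
    have "bij_betw ((`) (relabel g)) (homology (VR Y t) k) (homology (VR X (t / l)) k)"
      unfolding hom bij_betw_def by (auto intro!: inj_onI simp: inj_image_eq_iff inj_relabel g)
    from bij_betw_trans[OF this bij[OF t']]
    show "bij_betw (\<psi> t) (pspace (VR_module F k Y) t) (pspace (interval_sum qs) t)"
      by (simp add: VR_module_def interval_sum_def supp \<psi>_def[abs_def] o_def)
    fix A assume A: "A \<in> pspace (VR_module F k Y) t"
    then have gA: "relabel g ` A \<in> homology (VR X (t / l)) k"
      by (simp add: hom VR_module_def)
    show "\<psi> t (pscale (VR_module F k Y) t a A) = pscale (interval_sum qs) t a (\<psi> t A)" for a
      using scale[OF t' gA] by (simp add: VR_module_def interval_sum_def \<psi>_def VR homology_scale_image g)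
    fix B assume "B \<in> pspace (VR_module F k Y) t"
    then have "relabel g ` B \<in> homology (VR X (t / l)) k"
      by (simp add: hom VR_module_def)
    from add[OF t' gA this]
    show "\<psi> t (padd (VR_module F k Y) t A B) = padd (interval_sum qs) t (\<psi> t A) (\<psi> t B)"
      by (simp add: VR_module_def interval_sum_def \<psi>_def VR homology_add_image g)
  next
    fix s t A assume st: "0 \<le> s \<and> s \<le> t" and "A \<in> pspace (VR_module F k Y) s"
    then have "relabel g ` A \<in> homology (VR X (s / l)) k"
      by (simp add: hom VR_module_def)
    from incl[OF _ _ this, of "t / l"] st
    show "\<psi> t (pmap (VR_module F k Y) s t A) = pmap (interval_sum qs) s t (\<psi> s A)"
      by (simp add: t_l VR_module_def interval_sum_def \<psi>_def VR homology_incl_image g supp)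
  qed
  moreover have "mset qs = scale_dgm l D"
    using l ps(1) by (auto simp: qs_def scale_dgm_def)
  moreover have "\<forall>(b, d)\<in>set qs. 0 \<le> b \<and> b < d"
    using l ps(2) by (auto simp: qs_def)
  ultimately show ?thesis
    unfolding is_dgm_def by blast
qed

lemma bij_betw_extend_UNIV:
  fixes f :: "'a \<Rightarrow> 'a"
  assumes "finite A" and f: "inj_on f A"
  obtains h where "bij h" "\<And>x. x \<in> A \<Longrightarrow> h x = f x"
proof -
  define Z where "Z = A \<union> f ` A"
  have "card (Z - A) = card (Z - f ` A)"
    using assms by (simp add: Z_def card_Diff_subset card_image)
  then obtain e where e: "bij_betw e (Z - A) (Z - f ` A)"
    using \<open>finite A\<close> finite_same_card_bij[of "Z - A" "Z - f ` A"] by (auto simp: Z_def)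
  define h where "h x = (if x \<in> A then f x else if x \<in> Z then e x else x)" for x
  have "bij_betw h A (f ` A)"
    using f by (auto simp: h_def bij_betw_def inj_on_def)
  moreover have "bij_betw h (Z - A) (Z - f ` A)"
    using e by (subst bij_betw_cong[of _ _ e]) (auto simp: h_def)
  ultimately have "bij_betw h (A \<union> (Z - A)) (f ` A \<union> (Z - f ` A))"
    by (rule bij_betw_combine) auto
  then have "bij_betw h Z Z"
    by (simp add: Z_def Un_Diff_cancel Un_absorb1 Un_absorb2 Un_commute)
  moreover have "bij_betw h (- Z) (- Z)"
    by (subst bij_betw_cong[of _ _ id]) (auto simp: h_def Z_def)
  ultimately have "bij_betw h (Z \<union> - Z) (Z \<union> - Z)"
    by (rule bij_betw_combine) auto
  then have "bij h"
    by simp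
  then show thesis
    by (rule that) (simp add: h_def)
qed

lemma dgm_set_similarity:
  fixes X Y :: "'a metric"
  assumes "finite A" "card A \<le> n" and AX: "A \<subseteq> mspace X" and AY: "f ` A \<subseteq> mspace Y" and l: "l > 0"
    and dist: "\<And>x y. x \<in> A \<Longrightarrow> y \<in> A \<Longrightarrow> mdist Y (f x) (f y) = l * mdist X x y"
    and D: "is_dgm F k (submetric X A) D"
  shows "scale_dgm l D \<in> dgm_set F n k Y"
proof -
  have f: "inj_on f A"
  proof
    fix x y assume xy: "x \<in> A" "y \<in> A" "f x = f y"
    then have "mdist Y (f x) (f y) = 0"
      using AY by (metis mdist_zero image_subset_iff)
    with l have "mdist X x y = 0"
      unfolding dist[OF xy(1,2)] by simp
    with xy AX show "x = y"
      by (metis mdist_zero subsetD)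
  qed
  obtain h where h: "bij h" "\<And>x. x \<in> A \<Longrightarrow> h x = f x"
    using bij_betw_extend_UNIV[OF \<open>finite A\<close> f] by blast
  have inv: "inv h (f x) = x" if "x \<in> A" for x
    using h that by (metis bij_inv_eq_iff)
  have "is_dgm F k (submetric Y (f ` A)) (scale_dgm l D)"
  proof (rule is_dgm_similarity[OF bij_imp_bij_inv[OF h(1)] l _ _ D])
    have "inv h ` f ` A = A"
      using inv by (simp add: image_image)
    then show "inv h ` mspace (submetric Y (f ` A)) = mspace (submetric X A)"
      using AX AY by (simp add: Int_absorb1 Int_absorb2)
  qed (use inv dist in auto)
  moreover have "card (f ` A) \<le> n"
    using card_image_le[OF \<open>finite A\<close>, of f] \<open>card A \<le> n\<close> by linarith
  ultimately show ?thesis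
    unfolding dgm_set_def using AY \<open>finite A\<close> by blast
qed

section \<open>Scaling of diagrams and the empty diagram\<close>

lemma scale_dgm_1 [simp]: "scale_dgm 1 D = D"
  by (simp add: scale_dgm_def)

lemma scale_dgm_scale_dgm: "l \<noteq> 0 \<Longrightarrow> m \<noteq> 0 \<Longrightarrow> scale_dgm l (scale_dgm m D) = scale_dgm (l * m) D"
  by (simp add: scale_dgm_def multiset.map_comp o_def case_prod_unfold mult.assoc)

lemma boundary_zero [simp]: "boundary (\<lambda>_. 0) = (\<lambda>_. 0)"
  by (simp add: boundary_def fun_eq_iff)

text \<open>The only simplex available is the empty one, which lives in \<open>p = 0\<close>. All
  chain spaces that enter degree \<open>k \<ge> 0\<close> have \<open>p \<ge> 1\<close> and are
  therefore zero.\<close>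

lemma homology_empty: "homology {} k = {{\<lambda>_ :: 'a list. 0 :: 'f::field}}"
proof -
  have "(chains {} (Suc p) :: ('a list \<Rightarrow> 'f) set) = {\<lambda>_. 0}" for p
    by (fastforce simp: chains_def fun_eq_iff)
  then show ?thesis
    by (auto simp: homology_def quotient_def homologous_def cycles_def boundaries_def)
qed

text \<open>The empty subset realises it. This supplies the contribution of the factor 0 to the
  union over all factors.\<close>

lemma empty_in_dgm_set: "{#} \<in> dgm_set F n k X"
proof -
  have VR: "VR (submetric X {}) t = {}" for t
    by (auto simp: VR_def)
  have "pmodule_iso (VR_module F k (submetric X {})) (interval_sum [])"
    unfolding pmodule_iso_def
    by (rule exI[of _ "\<lambda>_ _ _. 0"])
      (auto simp: VR_module_def interval_sum_def interval_support_def VR homology_empty bij_betw_def)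
  then have "is_dgm F k (submetric X {}) {#}"
    by (auto simp: is_dgm_def)
  then show ?thesis
    unfolding dgm_set_def by (intro CollectI exI[of _ "{}"]) simp
qed


section \<open>Finite subsets of spheres\<close>

text \<open>Fewer than \<open>N\<close> homogeneous linear equations in \<open>N\<close> unknowns
  have a nontrivial solution. The induction on \<open>N\<close> is Gaussian elimination of the last
  unknown.\<close>

lemma orthogonal_vector_exists:
  fixes V :: "(nat \<Rightarrow> real) set"
  assumes "finite V" "card V < N"
  shows "\<exists>w. (\<exists>i<N. w i \<noteq> 0) \<and> (\<forall>v\<in>V. (\<Sum>i<N. v i * w i) = 0)"
  using assms
proof (induction N arbitrary: V)
  case (Suc N)
  show ?case
  proof (cases "\<forall>v\<in>V. v N = 0")
    case True
    then show ?thesis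
      by (intro exI[of _ "\<lambda>i. if i = N then 1 else 0"]) auto
  next
    case False
    then obtain v0 where v0: "v0 \<in> V" "v0 N \<noteq> 0"
      by blast
    \<comment> \<open>\<open>v0\<close> is the pivot: \<open>p v\<close> is \<open>v\<close> with
      its last coordinate cleared. Leaving out the pivot itself lowers the number of equations along
      with the number of unknowns.\<close>
    define p where "p v i = v i - v N / v0 N * v0 i" for v :: "nat \<Rightarrow> real" and i
    have "card (p ` (V - {v0})) < N"
      using card_image_le[of "V - {v0}" p] Suc.prems v0 card_gt_0_iff[of V] by fastforce
    then obtain w where w: "\<exists>i<N. w i \<noteq> 0" "\<And>v. v \<in> V - {v0} \<Longrightarrow> (\<Sum>i<N. p v i * w i) = 0"
      using Suc.IH[of "p ` (V - {v0})"] Suc.prems by auto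
    \<comment> \<open>Back substitution: the last coordinate is the one that solves the equation of
      the pivot.\<close>
    define w' where "w' = w(N := - (\<Sum>i<N. v0 i * w i) / v0 N)"
    have sum_w': "(\<Sum>i<Suc N. v i * w' i) = (\<Sum>i<N. v i * w i) + v N * w' N" for v
      by (simp add: w'_def)
    have "(\<Sum>i<Suc N. v i * w' i) = 0" if "v \<in> V" for v
    proof (cases "v = v0")
      case True
      then show ?thesis
        using v0 by (simp add: sum_w') (simp add: w'_def)
    next
      case False
      then have "0 = (\<Sum>i<N. p v i * w i)"
        using w that by simp
      also have "\<dots> = (\<Sum>i<N. v i * w i - v N / v0 N * (v0 i * w i))"
        by (simp add: p_def algebra_simps)
      also have "\<dots> = (\<Sum>i<N. v i * w i) - v N / v0 N * (\<Sum>i<N. v0 i * w i)"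
        by (simp add: sum_subtractf sum_distrib_left)
      finally show ?thesis
        by (simp add: sum_w') (simp add: w'_def)
    qed
    moreover have "\<exists>i<Suc N. w' i \<noteq> 0"
      using w(1) by (auto simp: w'_def intro: less_SucI)
    ultimately show ?thesis
      by blast
  qed
qed simp

text \<open>The sums run over the \<open>N + 1\<close> coordinates up to \<open>N\<close>, so
  \<open>N\<close> vectors still leave a nonzero common normal, which is then divided by its
  length.\<close>

lemma unit_normal_exists:
  fixes V :: "(nat \<Rightarrow> real) set"
  assumes "finite V" "card V \<le> N"
  obtains w where "(\<Sum>i\<le>N. (w i)\<^sup>2) = 1" "\<And>v. v \<in> V \<Longrightarrow> (\<Sum>i\<le>N. v i * w i) = 0"
proof -
  obtain w where w: "\<exists>i\<le>N. w i \<noteq> 0" "\<And>v. v \<in> V \<Longrightarrow> (\<Sum>i\<le>N. v i * w i) = 0"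
    using orthogonal_vector_exists[of V "Suc N"] assms by (auto simp: lessThan_Suc_atMost less_Suc_eq_le)
  define r where "r = sqrt (\<Sum>i\<le>N. (w i)\<^sup>2)"
  have "(\<Sum>i\<le>N. (w i)\<^sup>2) > 0"
    using w(1) by (auto intro!: sum_pos2)
  then have r: "r > 0" "r\<^sup>2 = (\<Sum>i\<le>N. (w i)\<^sup>2)"
    by (simp_all add: r_def)
  show thesis
  proof (rule that[of "\<lambda>i. w i / r"])
    show "(\<Sum>i\<le>N. (w i / r)\<^sup>2) = 1"
      using r(1) by (simp add: power_divide flip: sum_divide_distrib r(2))
    show "(\<Sum>i\<le>N. v i * (w i / r)) = 0" if "v \<in> V" for v
      using w(2)[OF that] by (simp flip: sum_divide_distrib)
  qed
qed

text \<open>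
  \<open>R\<close> is the Householder reflection exchanging \<open>w\<close> with the last basis vector; if they are equal,
  the division by zero in its formula makes it the identity.
\<close>

lemma rotate_to_last_coordinate:
  fixes w :: "nat \<Rightarrow> real"
  assumes w: "(\<Sum>i\<le>N. (w i)\<^sup>2) = 1"
  obtains R where
    "\<And>x y i. R (\<lambda>i. x i - y i) i = R x i - R y i"
    "\<And>x. (\<Sum>i\<le>N. (R x i)\<^sup>2) = (\<Sum>i\<le>N. (x i)\<^sup>2)"
    "\<And>x. R x N = (\<Sum>i\<le>N. x i * w i)"
proof -
  define u where "u i = w i - (if i = N then 1 else 0)" for i
  define q where "q = (\<Sum>i\<le>N. (u i)\<^sup>2)"
  define p where "p x = (\<Sum>i\<le>N. x i * u i)" for x
  define R where "R x i = x i - 2 * p x / q * u i" for x i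
  have p_eq: "p x = (\<Sum>i\<le>N. x i * w i) - x N" for x
  proof -
    have "p x = (\<Sum>i\<le>N. x i * w i - (if i = N then x N else 0))"
      unfolding p_def by (rule sum.cong) (simp_all add: u_def right_diff_distrib)
    then show ?thesis
      by (simp add: sum_subtractf)
  qed
  \<comment> \<open>Both \<open>w\<close> and the last basis vector have length 1, so the squared
    length \<open>q\<close> of their difference depends only on their inner product
    \<open>w N\<close>.\<close>
  have "p w = 1 - w N"
    unfolding p_eq using w by (simp add: power2_eq_square)
  moreover have "q = p u"
    by (simp add: q_def p_def power2_eq_square)
  moreover have "(\<Sum>i\<le>N. u i * w i) = p w"
    by (simp add: p_def mult.commute)
  ultimately have q: "q = 2 - 2 * w N"
    using p_eq[of u] by (simp add: u_def[of N])
  show thesis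
  proof (rule that[of R])
    fix x y :: "nat \<Rightarrow> real" and i
    have "p (\<lambda>i. x i - y i) = p x - p y"
      by (simp add: p_def left_diff_distrib sum_subtractf)
    then show "R (\<lambda>i. x i - y i) i = R x i - R y i"
      by (simp only: R_def) (simp add: diff_divide_distrib left_diff_distrib right_diff_distrib)
    have "(\<Sum>i\<le>N. (R x i)\<^sup>2) =
        (\<Sum>i\<le>N. (x i)\<^sup>2 - 4 * (p x / q) * (x i * u i) + 4 * (p x / q)\<^sup>2 * (u i)\<^sup>2)"
      by (rule sum.cong) (simp_all add: R_def power2_eq_square algebra_simps)
    also have "\<dots> = (\<Sum>i\<le>N. (x i)\<^sup>2) - 4 * (p x / q) * p x + 4 * (p x / q)\<^sup>2 * q"
      by (simp only: sum.distrib sum_subtractf p_def[of x] q_def sum_distrib_left[symmetric])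
    \<comment> \<open>For \<open>q \<noteq> 0\<close> both correction terms have size
      \<open>4 * (p x)\<^sup>2 / q\<close> and cancel.\<close>
    also have "\<dots> = (\<Sum>i\<le>N. (x i)\<^sup>2)"
      by (cases "q = 0") (simp_all add: power2_eq_square)
    finally show "(\<Sum>i\<le>N. (R x i)\<^sup>2) = (\<Sum>i\<le>N. (x i)\<^sup>2)" .
    show "R x N = (\<Sum>i\<le>N. x i * w i)"
    proof (cases "q = 0")
      case True
      then have "u i = 0" if "i \<le> N" for i
        using that by (simp add: q_def sum_nonneg_eq_0_iff)
      then have "p x = 0"
        by (simp add: p_def)
      then show ?thesis
        using p_eq[of x] by (simp add: R_def)
    next
      case False
      \<comment> \<open>Since \<open>u N = w N - 1\<close> is \<open>- q / 2\<close>, the reflection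
        adds exactly \<open>p x\<close> to the last coordinate.\<close>
      then have "R x N = x N + p x"
        by (simp add: R_def q u_def field_simps)
      then show ?thesis
        by (simp add: p_eq)
    qed
  qed
qed

section \<open>Moving finite sets between spheres of adjacent dimensions\<close>

text \<open>At most \<open>m + 1\<close> vectors with \<open>m + 2\<close> coordinates have a common
  unit normal. Once it is rotated to the last axis, the last coordinate of every point is 0, and
  dropping it changes neither norms nor distances.\<close>

lemma sphere_subset_isometric:
  assumes "finite A" "card A \<le> Suc m" "A \<subseteq> mspace (Euclidean_sphere (Suc m))"
  obtains f where "f ` A \<subseteq> mspace (Euclidean_sphere m)"
    "\<And>x y. x \<in> A \<Longrightarrow> y \<in> A \<Longrightarrow>
      mdist (Euclidean_sphere m) (f x) (f y) = mdist (Euclidean_sphere (Suc m)) x y"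
proof -
  obtain w where w: "(\<Sum>i\<le>Suc m. (w i)\<^sup>2) = 1" "\<And>v. v \<in> A \<Longrightarrow> (\<Sum>i\<le>Suc m. v i * w i) = 0"
    using unit_normal_exists[OF assms(1,2)] by blast
  obtain R where R: "\<And>x y i. R (\<lambda>i. x i - y i) i = R x i - R y i"
    "\<And>x. (\<Sum>i\<le>Suc m. (R x i)\<^sup>2) = (\<Sum>i\<le>Suc m. (x i)\<^sup>2)"
    "\<And>x. R x (Suc m) = (\<Sum>i\<le>Suc m. x i * w i)"
    by (rule rotate_to_last_coordinate[OF w(1)]) blast
  have last: "R x (Suc m) = 0" if "x \<in> A" for x
    using w(2)[OF that] R(3) by simp
  show thesis
  \<comment> \<open>The cut-off is explicit because \<open>R\<close> is only controlled up to
    coordinate \<open>Suc m\<close>, while points of the smaller sphere must vanish beyond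
    \<open>m\<close>.\<close>
  proof (rule that[of "\<lambda>x i. if i \<le> m then R x i else 0"])
    show "(\<lambda>x i. if i \<le> m then R x i else 0) ` A \<subseteq> mspace (Euclidean_sphere m)"
    proof (intro image_subsetI)
      fix x assume x: "x \<in> A"
      with assms(3) have "(\<Sum>i\<le>Suc m. (x i)\<^sup>2) = 1"
        unfolding mspace_Euclidean_sphere by blast
      with R(2)[of x] last[OF x] show "(\<lambda>i. if i \<le> m then R x i else 0) \<in> mspace (Euclidean_sphere m)"
        by (simp add: mspace_Euclidean_sphere)
    qed
    fix x y assume "x \<in> A" "y \<in> A"
    then show "mdist (Euclidean_sphere m) (\<lambda>i. if i \<le> m then R x i else 0) (\<lambda>i. if i \<le> m then R y i else 0)
        = mdist (Euclidean_sphere (Suc m)) x y"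
      using R(2)[of "\<lambda>i. x i - y i"] unfolding R(1) by (simp add: mdist_Euclidean_sphere last)
  qed
qed

text \<open>With at most \<open>m + 1\<close> points the factor is 1. Exactly \<open>m + 2\<close>
  points span a proper affine subspace, so they lie on a parallel whose radius is the factor
  \<open>l\<close>.\<close>

lemma sphere_subset_similar:
  assumes "finite A" "card A \<le> Suc (Suc m)" "A \<subseteq> mspace (Euclidean_sphere (Suc m))"
  obtains f l where "0 < l" "l \<le> 1" "f ` A \<subseteq> mspace (Euclidean_sphere m)"
    "\<And>x y. x \<in> A \<Longrightarrow> y \<in> A \<Longrightarrow>
      mdist (Euclidean_sphere (Suc m)) x y = l * mdist (Euclidean_sphere m) (f x) (f y)"
proof (cases "card A \<le> Suc m")
  case True
  then show ?thesis
    using sphere_subset_isometric[OF assms(1) True assms(3)] that[of 1] by (metis mult_1 order_refl zero_less_one)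
next
  case False
  then have card: "card A = Suc (Suc m)"
    using assms(2) by simp
  then obtain x0 where x0: "x0 \<in> A"
    by fastforce
  \<comment> \<open>Only \<open>m + 1\<close> differences from the base point \<open>x0\<close>
    remain, few enough for a common normal; orthogonality to them makes the height over the
    hyperplane constant on \<open>A\<close>.\<close>
  define V where "V = (\<lambda>x i. x i - x0 i) ` (A - {x0})"
  have "finite V" "card V \<le> Suc m"
    using assms(1) card x0 card_image_le[of "A - {x0}" "\<lambda>x i. x i - x0 i"] by (auto simp: V_def)
  then obtain w where w: "(\<Sum>i\<le>Suc m. (w i)\<^sup>2) = 1" "\<And>v. v \<in> V \<Longrightarrow> (\<Sum>i\<le>Suc m. v i * w i) = 0"
    using unit_normal_exists by metis
  obtain R where R: "\<And>x y i. R (\<lambda>i. x i - y i) i = R x i - R y i"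
    "\<And>x. (\<Sum>i\<le>Suc m. (R x i)\<^sup>2) = (\<Sum>i\<le>Suc m. (x i)\<^sup>2)"
    "\<And>x. R x (Suc m) = (\<Sum>i\<le>Suc m. x i * w i)"
    by (rule rotate_to_last_coordinate[OF w(1)]) blast
  define c where "c = R x0 (Suc m)"
  have last: "R x (Suc m) = c" if "x \<in> A" for x
  proof (cases "x = x0")
    case False
    with that have "(\<lambda>i. x i - x0 i) \<in> V"
      by (auto simp: V_def)
    then have "R (\<lambda>i. x i - x0 i) (Suc m) = 0"
      using w(2) R(3) by metis
    then show ?thesis
      unfolding R(1) c_def by simp
  qed (simp add: c_def)
  have norm: "(\<Sum>i\<le>m. (R x i)\<^sup>2) = 1 - c\<^sup>2" if "x \<in> A" for x
  proof -
    have "(\<Sum>i\<le>Suc m. (x i)\<^sup>2) = 1"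
      using that assms(3) unfolding mspace_Euclidean_sphere by blast
    with R(2)[of x] last[OF that] show ?thesis
      by simp
  qed
  have dist: "mdist (Euclidean_sphere (Suc m)) x y = sqrt (\<Sum>i\<le>m. (R x i - R y i)\<^sup>2)"
    if "x \<in> A" "y \<in> A" for x y
    using R(2)[of "\<lambda>i. x i - y i"] that unfolding R(1) by (simp add: mdist_Euclidean_sphere last)
  have "1 - c\<^sup>2 \<ge> 0"
    using norm[OF x0] by (metis sum_nonneg zero_le_power2)
  \<comment> \<open>Radius 0 would shrink the parallel to a pole and \<open>A\<close> to one point,
    but \<open>A\<close> has at least two.\<close>
  moreover have "1 - c\<^sup>2 \<noteq> 0"
  proof
    assume "1 - c\<^sup>2 = 0"
    then have zero: "R x i = 0" if "x \<in> A" "i \<le> m" for x i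
      using norm that by (simp add: sum_nonneg_eq_0_iff)
    have "x = x0" if "x \<in> A" for x
    proof -
      have "mdist (Euclidean_sphere (Suc m)) x x0 = 0"
        using that x0 by (simp add: dist zero)
      then show ?thesis
        using that x0 assms(3) by (metis mdist_zero subsetD)
    qed
    then have "A \<subseteq> {x0}"
      by blast
    then have "card A \<le> 1"
      using card_mono[of "{x0}" A] by simp
    with card show False
      by simp
  qed
  ultimately have pos: "1 - c\<^sup>2 > 0"
    by simp
  define l where "l = sqrt (1 - c\<^sup>2)"
  have l: "l > 0" "l\<^sup>2 = 1 - c\<^sup>2" "l \<le> 1"
    using pos by (auto simp: l_def)
  show thesis
  proof (rule that[OF l(1,3), of "\<lambda>x i. if i \<le> m then R x i / l else 0"])
    show "(\<lambda>x i. if i \<le> m then R x i / l else 0) ` A \<subseteq> mspace (Euclidean_sphere m)"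
      using norm l pos by (auto simp: mspace_Euclidean_sphere power_divide simp flip: sum_divide_distrib)
    fix x y assume "x \<in> A" "y \<in> A"
    then show "mdist (Euclidean_sphere (Suc m)) x y =
      l * mdist (Euclidean_sphere m) (\<lambda>i. if i \<le> m then R x i / l else 0) (\<lambda>i. if i \<le> m then R y i / l else 0)"
      using l(1) by (simp only: dist) (simp add: mdist_Euclidean_sphere power_divide real_sqrt_divide
          flip: diff_divide_distrib sum_divide_distrib)
  qed
qed

text \<open>The sphere is shrunk by \<open>l\<close> and lifted to height
  \<open>sqrt (1 - l\<^sup>2)\<close>. The common height cancels in every distance.\<close>

lemma sphere_parallel:
  assumes "0 \<le> l" "l \<le> 1"
  obtains f where "f ` mspace (Euclidean_sphere m) \<subseteq> mspace (Euclidean_sphere (Suc m))"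
    "\<And>x y. mdist (Euclidean_sphere (Suc m)) (f x) (f y) = l * mdist (Euclidean_sphere m) x y"
proof (rule that[of "\<lambda>x i. if i \<le> m then l * x i else if i = Suc m then sqrt (1 - l\<^sup>2) else 0"])
  have "1 - l\<^sup>2 \<ge> 0"
    using assms by (simp add: power_le_one)
  then show "(\<lambda>x i. if i \<le> m then l * x i else if i = Suc m then sqrt (1 - l\<^sup>2) else 0) `
      mspace (Euclidean_sphere m) \<subseteq> mspace (Euclidean_sphere (Suc m))"
    by (auto simp: mspace_Euclidean_sphere power_mult_distrib simp flip: sum_distrib_left)
  fix x y :: "nat \<Rightarrow> real"
  show "mdist (Euclidean_sphere (Suc m))
      (\<lambda>i. if i \<le> m then l * x i else if i = Suc m then sqrt (1 - l\<^sup>2) else 0)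
      (\<lambda>i. if i \<le> m then l * y i else if i = Suc m then sqrt (1 - l\<^sup>2) else 0) =
      l * mdist (Euclidean_sphere m) x y"
    using assms by (simp add: mdist_Euclidean_sphere power_mult_distrib real_sqrt_mult
        flip: right_diff_distrib sum_distrib_left)
qed

section \<open>Comparing the diagram sets of spheres\<close>

lemma scale_dgm_set_sphere_subset:
  assumes "0 < l" "l \<le> 1"
  shows "scale_dgm l ` dgm_set F n k (Euclidean_sphere m) \<subseteq> dgm_set F n k (Euclidean_sphere (Suc m))"
proof (rule image_subsetI)
  fix D assume "D \<in> dgm_set F n k (Euclidean_sphere m)"
  then obtain A where A: "A \<subseteq> mspace (Euclidean_sphere m)" "finite A" "card A \<le> n"
    and D: "is_dgm F k (submetric (Euclidean_sphere m) A) D"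
    by (auto simp: dgm_set_def)
  obtain f where f: "f ` mspace (Euclidean_sphere m) \<subseteq> mspace (Euclidean_sphere (Suc m))"
    "\<And>x y. mdist (Euclidean_sphere (Suc m)) (f x) (f y) = l * mdist (Euclidean_sphere m) x y"
    using sphere_parallel[of l m] assms by (metis less_imp_le)
  have "f ` A \<subseteq> mspace (Euclidean_sphere (Suc m))"
    using A(1) f(1) by blast
  then show "scale_dgm l D \<in> dgm_set F n k (Euclidean_sphere (Suc m))"
    by (rule dgm_set_similarity[OF A(2,3,1) _ assms(1) f(2) D])
qed

lemma dgm_set_sphere_Suc:
  assumes "n \<le> Suc m"
  shows "dgm_set F n k (Euclidean_sphere (Suc m)) = dgm_set F n k (Euclidean_sphere m)"
proof
  show "dgm_set F n k (Euclidean_sphere m) \<subseteq> dgm_set F n k (Euclidean_sphere (Suc m))"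
    \<comment> \<open>The factor 1 is the inclusion of the equator.\<close>
    using scale_dgm_set_sphere_subset[of 1 F n k m] by (simp add: image_def)
  show "dgm_set F n k (Euclidean_sphere (Suc m)) \<subseteq> dgm_set F n k (Euclidean_sphere m)"
  proof
    fix D assume "D \<in> dgm_set F n k (Euclidean_sphere (Suc m))"
    then obtain A where A: "A \<subseteq> mspace (Euclidean_sphere (Suc m))" "finite A" "card A \<le> n"
      and D: "is_dgm F k (submetric (Euclidean_sphere (Suc m)) A) D"
      by (auto simp: dgm_set_def)
    obtain f where f: "f ` A \<subseteq> mspace (Euclidean_sphere m)"
      "\<And>x y. x \<in> A \<Longrightarrow> y \<in> A \<Longrightarrow>
        mdist (Euclidean_sphere m) (f x) (f y) = mdist (Euclidean_sphere (Suc m)) x y"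
      using sphere_subset_isometric[OF A(2) _ A(1)] A(3) assms by (metis le_trans)
    show "D \<in> dgm_set F n k (Euclidean_sphere m)"
      using dgm_set_similarity[OF A(2,3,1) f(1) zero_less_one _ D] f(2) by simp
  qed
qed

lemma dgm_set_sphere_eq_scaled:
  "dgm_set F (Suc (Suc m)) k (Euclidean_sphere (Suc m)) =
     (\<Union>l\<in>{0..1}. scale_dgm l ` dgm_set F (Suc (Suc m)) k (Euclidean_sphere m))"
    (is "?S = (\<Union>l\<in>_. scale_dgm l ` ?T)")
proof (intro subset_antisym UN_least)
  fix l :: real assume "l \<in> {0..1}"
  then show "scale_dgm l ` ?T \<subseteq> ?S"
    \<comment> \<open>For \<open>l = 0\<close> every diagram becomes empty, and the empty diagram
      always belongs to \<open>?S\<close>.\<close>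
    using scale_dgm_set_sphere_subset[of l F _ k m] empty_in_dgm_set
    by (cases "l = 0") (auto simp: scale_dgm_def)
next
  show "?S \<subseteq> (\<Union>l\<in>{0..1}. scale_dgm l ` ?T)"
  proof
    fix D assume "D \<in> ?S"
    then obtain A where A: "A \<subseteq> mspace (Euclidean_sphere (Suc m))" "finite A" "card A \<le> Suc (Suc m)"
      and D: "is_dgm F k (submetric (Euclidean_sphere (Suc m)) A) D"
      by (auto simp: dgm_set_def)
    obtain f l where l: "0 < l" "l \<le> 1" and f: "f ` A \<subseteq> mspace (Euclidean_sphere m)"
      "\<And>x y. x \<in> A \<Longrightarrow> y \<in> A \<Longrightarrow>
        mdist (Euclidean_sphere (Suc m)) x y = l * mdist (Euclidean_sphere m) (f x) (f y)"
      by (rule sphere_subset_similar[OF A(2,3,1)]) blast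
    \<comment> \<open>Passing to the smaller sphere multiplies distances by \<open>1 / l\<close>, so
      \<open>D\<close> itself is recovered by scaling back with \<open>l\<close>.\<close>
    have "scale_dgm (1 / l) D \<in> ?T"
      by (rule dgm_set_similarity[OF A(2,3,1) f(1) _ _ D]) (use l f(2) in auto)
    moreover have "D = scale_dgm l (scale_dgm (1 / l) D)"
      using l by (simp add: scale_dgm_scale_dgm)
    ultimately show "D \<in> (\<Union>l\<in>{0..1}. scale_dgm l ` ?T)"
      using l by (intro UN_I[of l]) auto
  qed
qed

theorem proposition5p21:
  fixes F :: "'f::field itself" and n m k :: nat
  assumes "n \<ge> 2" and "m \<ge> n - 1"
  shows "dgm_set F n k (Euclidean_sphere m) = dgm_set F n k (Euclidean_sphere (n - 1)) \<and>
         dgm_set F n k (Euclidean_sphere (n - 1)) =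
           (\<Union>l\<in>{0..1::real}. scale_dgm l ` dgm_set F n k (Euclidean_sphere (n - 2)))"
proof
  show "dgm_set F n k (Euclidean_sphere m) = dgm_set F n k (Euclidean_sphere (n - 1))"
    \<comment> \<open>The induction starts at dimension \<open>n - 1\<close>. Each step raises a
      dimension that is at least \<open>n - 1\<close>, as \<open>dgm_set_sphere_Suc\<close>
      demands.\<close>
    using assms(2) by (induction m rule: dec_induct) (simp_all add: dgm_set_sphere_Suc)
  obtain j where "n = Suc (Suc j)"
    using assms(1) by (metis add_2_eq_Suc le_Suc_ex)
  then show "dgm_set F n k (Euclidean_sphere (n - 1)) =
      (\<Union>l\<in>{0..1}. scale_dgm l ` dgm_set F n k (Euclidean_sphere (n - 2)))"
    using dgm_set_sphere_eq_scaled[of F j k] by simp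
qed

end
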